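(* Let $p\in[2,\infty)$, and let $a=(a^{ij}_{\alpha\beta})$ (real-valued) and $\sigma=(\sigma^{ik}_{\alpha\beta})$ (with $\sigma^i_{\alpha\beta}=(\sigma^{ik}_{\alpha\beta})_{k\ge1}$ $\ell^2$-valued) be measurable functions on $\mathbf R^d\times[0,\infty)\times\Omega$. Then $a$ and $\sigma$ satisfy the MSP condition (with exponent $p$) if either (i) $2a^{ij}_{\alpha\beta}-(p-1)\sigma^{ik}_{\gamma\alpha}\sigma^{jk}_{\gamma\beta}$, or (ii) $2a^{ij}_{\alpha\beta}-\sigma^{ik}_{\gamma\alpha}\sigma^{jk}_{\gamma\beta}-(p-2)\widehat\sigma^{ik}_{\gamma\alpha}\widehat\sigma^{jk}_{\gamma\beta}$ with $\widehat\sigma^{ik}_{\alpha\beta}:=(\sigma^{ik}_{\alpha\beta}-\sigma^{ik}_{\beta\alpha})/2$ satisfies the Legendre–Hadamard condition.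
   Context: Indices: $i,j=1,\dots,d$; $\alpha,\beta,\gamma=1,\dots,N$; $k=1,2,\dots$; summation over repeated indices ($\gamma$ and $k$ in the displayed expressions) is understood. $\Omega$ is the sample space of a probability space. Legendre–Hadamard condition: a family of real functions $A^{ij}_{\alpha\beta}$ on $\mathbf R^d\times[0,\infty)\times\Omega$ satisfies it if there is a constant $\kappa>0$ such that $A^{ij}_{\alpha\beta}\xi_i\xi_j\eta^\alpha\eta^\beta\ge\kappa|\xi|^2|\eta|^2$ for all $\xi\in\mathbf R^d$, $\eta\in\mathbf R^N$, everywhere on $\mathbf R^d\times[0,\infty)\times\Omega$. MSP (modified stochastic parabolicity) condition with exponent $p$: there are measurable functions $\lambda^{ik}_{\alpha\beta}:\mathbf R^d\times[0,\infty)\times\Omega\to\mathbf R$ with $\lambda^{ik}_{\alpha\beta}=\lambda^{ik}_{\beta\alpha}$ such that $$\mathcal A^{ij}_{\alpha\beta}(p,\lambda):=2a^{ij}_{\alpha\beta}-\sigma^{ik}_{\gamma\alpha}\sigma^{jk}_{\gamma\beta}-(p-2)(\sigma^{ik}_{\gamma\alpha}-\lambda^{ik}_{\gamma\alpha})(\sigma^{jk}_{\gamma\beta}-\lambda^{jk}_{\gamma\beta})$$ satisfies the Legendre–Hadamard condition. *)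

theory Defs
  imports "HOL-Probability.Probability"
begin

text \<open>
  The dimensions \<open>d\<close> and \<open>N\<close> are the cardinalities of the finite index types \<open>'d\<close> and \<open>'n\<close>.
  A family with two spatial indices is written \<open>A i j \<alpha> \<beta> z\<close> for
  \<open>A\<^sup>i\<^sup>j\<^sub>\<alpha>\<^sub>\<beta>(z)\<close>, and one with an \<open>\<ell>\<^sup>2\<close>-index is written \<open>s i k \<alpha> \<beta> z\<close> for
  \<open>s\<^sup>i\<^sup>k\<^sub>\<alpha>\<^sub>\<beta>(z)\<close>, where \<open>z = (x, t, \<omega>)\<close>. The index \<open>k\<close> starts at 0 instead of 1.
\<close>

type_synonym ('d, 'w) point = "(real ^ 'd) \<times> real \<times> 'w"

definition param_space :: "'w measure \<Rightarrow> ('d::finite, 'w) point measure" where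
  "param_space M = borel \<Otimes>\<^sub>M restrict_space borel {0..} \<Otimes>\<^sub>M M"

definition legendre_hadamard ::
  "'w measure \<Rightarrow> ('d::finite \<Rightarrow> 'd \<Rightarrow> 'n::finite \<Rightarrow> 'n \<Rightarrow> ('d, 'w) point \<Rightarrow> real) \<Rightarrow> bool" where
  "legendre_hadamard M A \<longleftrightarrow>
     (\<exists>\<kappa>>0. \<forall>z\<in>space (param_space M). \<forall>(\<xi> :: real ^ 'd) (\<eta> :: real ^ 'n).
        (\<Sum>i\<in>UNIV. \<Sum>j\<in>UNIV. \<Sum>\<alpha>\<in>UNIV. \<Sum>\<beta>\<in>UNIV. A i j \<alpha> \<beta> z * \<xi> $ i * \<xi> $ j * \<eta> $ \<alpha> * \<eta> $ \<beta>)
          \<ge> \<kappa> * (norm \<xi>)\<^sup>2 * (norm \<eta>)\<^sup>2)"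

definition contraction ::
  "('d \<Rightarrow> nat \<Rightarrow> 'n::finite \<Rightarrow> 'n \<Rightarrow> 'z \<Rightarrow> real) \<Rightarrow> 'd \<Rightarrow> 'd \<Rightarrow> 'n \<Rightarrow> 'n \<Rightarrow> 'z \<Rightarrow> real" where
  "contraction s i j \<alpha> \<beta> z = (\<Sum>\<gamma>\<in>UNIV. \<Sum>k. s i k \<gamma> \<alpha> z * s j k \<gamma> \<beta> z)"

definition MSP_form ::
  "real \<Rightarrow> ('d \<Rightarrow> 'd \<Rightarrow> 'n::finite \<Rightarrow> 'n \<Rightarrow> 'z \<Rightarrow> real) \<Rightarrow> ('d \<Rightarrow> nat \<Rightarrow> 'n \<Rightarrow> 'n \<Rightarrow> 'z \<Rightarrow> real)
    \<Rightarrow> ('d \<Rightarrow> nat \<Rightarrow> 'n \<Rightarrow> 'n \<Rightarrow> 'z \<Rightarrow> real) \<Rightarrow> 'd \<Rightarrow> 'd \<Rightarrow> 'n \<Rightarrow> 'n \<Rightarrow> 'z \<Rightarrow> real" where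
  "MSP_form p a \<sigma> l i j \<alpha> \<beta> z =
     2 * a i j \<alpha> \<beta> z - contraction \<sigma> i j \<alpha> \<beta> z
       - (p - 2) * contraction (\<lambda>i k \<alpha> \<beta> z. \<sigma> i k \<alpha> \<beta> z - l i k \<alpha> \<beta> z) i j \<alpha> \<beta> z"

text \<open>
  The summability clause says that the series over \<open>k\<close> in \<^const>\<open>MSP_form\<close> that involve \<open>l\<close>
  converge; without it \<^const>\<open>suminf\<close> would return an arbitrary value for a divergent series.
  For \<open>\<ell>\<^sup>2\<close>-valued \<open>\<sigma>\<close> it amounts to \<open>l\<close> being \<open>\<ell>\<^sup>2\<close>-valued (take \<open>i = j\<close>, \<open>\<alpha> = \<beta>\<close>).
\<close>

definition MSP_condition ::
  "'w measure \<Rightarrow> real \<Rightarrow> ('d::finite \<Rightarrow> 'd \<Rightarrow> 'n::finite \<Rightarrow> 'n \<Rightarrow> ('d, 'w) point \<Rightarrow> real)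
    \<Rightarrow> ('d \<Rightarrow> nat \<Rightarrow> 'n \<Rightarrow> 'n \<Rightarrow> ('d, 'w) point \<Rightarrow> real) \<Rightarrow> bool" where
  "MSP_condition M p a \<sigma> \<longleftrightarrow>
     (\<exists>l :: 'd \<Rightarrow> nat \<Rightarrow> 'n \<Rightarrow> 'n \<Rightarrow> ('d, 'w) point \<Rightarrow> real.
        (\<forall>i k \<alpha> \<beta>. l i k \<alpha> \<beta> \<in> borel_measurable (param_space M)) \<and>
        (\<forall>i k \<alpha> \<beta>. \<forall>z\<in>space (param_space M). l i k \<alpha> \<beta> z = l i k \<beta> \<alpha> z) \<and>
        (\<forall>i j \<alpha> \<beta> \<gamma>. \<forall>z\<in>space (param_space M).
           summable (\<lambda>k. (\<sigma> i k \<gamma> \<alpha> z - l i k \<gamma> \<alpha> z) * (\<sigma> j k \<gamma> \<beta> z - l j k \<gamma> \<beta> z))) \<and>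
        legendre_hadamard M (MSP_form p a \<sigma> l))"

text \<open>
  Since \<open>\<ell>\<^sup>2\<close> is separable, measurability of an \<open>\<ell>\<^sup>2\<close>-valued function is the same as
  measurability of its components.
\<close>

definition ell2_measurable :: "'z measure \<Rightarrow> ('z \<Rightarrow> nat \<Rightarrow> real) \<Rightarrow> bool" where
  "ell2_measurable Z f \<longleftrightarrow>
     (\<forall>z\<in>space Z. summable (\<lambda>k. (f z k)\<^sup>2)) \<and> (\<forall>k. (\<lambda>z. f z k) \<in> borel_measurable Z)"

definition antisym_part ::
  "('d \<Rightarrow> nat \<Rightarrow> 'n \<Rightarrow> 'n \<Rightarrow> 'z \<Rightarrow> real) \<Rightarrow> 'd \<Rightarrow> nat \<Rightarrow> 'n \<Rightarrow> 'n \<Rightarrow> 'z \<Rightarrow> real" where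
  "antisym_part \<sigma> i k \<alpha> \<beta> z = (\<sigma> i k \<alpha> \<beta> z - \<sigma> i k \<beta> \<alpha> z) / 2"

end

theory Submission
  imports Defs
begin

text \<open>Each alternative is the MSP form for one explicit symmetric \<open>l\<close>. For
  \<open>l = 0\<close> the two contractions of \<open>\<sigma>\<close> merge with total weight 1 +
  (p - 2) = p - 1, which gives (i). For \<open>l\<close> the symmetric part of
  \<open>\<sigma>\<close> in its last two indices, \<open>\<sigma> - l\<close> is the antisymmetric
  part, which gives (ii). The Legendre-Hadamard bound therefore carries over with the same constant.
  What remains is convergence of the series over \<open>k\<close>: products of square-summable
  sequences are summable, and half-differences of such sequences are again square-summable.\<close>

lemma summable_mult_of_summable_squares:
  fixes f g :: "nat \<Rightarrow> real"
  assumes "summable (\<lambda>k. (f k)\<^sup>2)" and "summable (\<lambda>k. (g k)\<^sup>2)"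
  shows "summable (\<lambda>k. f k * g k)"
proof (rule summable_comparison_test)
  show "\<exists>n0. \<forall>k\<ge>n0. norm (f k * g k) \<le> (f k)\<^sup>2 + (g k)\<^sup>2"
  proof (intro exI allI impI)
    fix k
    \<comment> \<open>Stated for absolute values, since the comparison test bounds the norm of the
      product.\<close>
    have "2 * (\<bar>f k\<bar> * \<bar>g k\<bar>) \<le> (f k)\<^sup>2 + (g k)\<^sup>2"
      using sum_squares_bound[of "\<bar>f k\<bar>" "\<bar>g k\<bar>"] by simp
    moreover have "0 \<le> \<bar>f k\<bar> * \<bar>g k\<bar>" by simp
    ultimately show "norm (f k * g k) \<le> (f k)\<^sup>2 + (g k)\<^sup>2"
      unfolding real_norm_def abs_mult by linarith
  qed
  show "summable (\<lambda>k. (f k)\<^sup>2 + (g k)\<^sup>2)"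
    using assms by (rule summable_add)
qed

text \<open>Expanding the square leaves a cross term, which the previous lemma controls. With
  \<open>g\<close> the transposed component of \<open>f\<close>, this makes
  \<open>antisym_part \<sigma>\<close> square-summable.\<close>

lemma summable_square_half_diff:
  fixes f g :: "nat \<Rightarrow> real"
  assumes "summable (\<lambda>k. (f k)\<^sup>2)" and "summable (\<lambda>k. (g k)\<^sup>2)"
  shows "summable (\<lambda>k. ((f k - g k) / 2)\<^sup>2)"
proof -
  have "summable (\<lambda>k. (f k)\<^sup>2 / 4 + (g k)\<^sup>2 / 4 - f k * g k / 2)"
    using assms summable_mult_of_summable_squares[OF assms]
    by (intro summable_add summable_diff summable_divide)
  moreover have "((f k - g k) / 2)\<^sup>2 = (f k)\<^sup>2 / 4 + (g k)\<^sup>2 / 4 - f k * g k / 2" for k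
    by (simp add: power2_eq_square field_simps)
  ultimately show ?thesis
    by simp
qed

theorem lemma1p3:
  fixes M :: "'w measure" and p :: real
    and a :: "'d::finite \<Rightarrow> 'd \<Rightarrow> 'n::finite \<Rightarrow> 'n \<Rightarrow> ('d, 'w) point \<Rightarrow> real"
    and \<sigma> :: "'d \<Rightarrow> nat \<Rightarrow> 'n \<Rightarrow> 'n \<Rightarrow> ('d, 'w) point \<Rightarrow> real"
  assumes "prob_space M"
    and "p \<ge> 2"
    and "\<And>i j \<alpha> \<beta>. a i j \<alpha> \<beta> \<in> borel_measurable (param_space M)"
    and "\<And>i \<alpha> \<beta>. ell2_measurable (param_space M) (\<lambda>z k. \<sigma> i k \<alpha> \<beta> z)"
    and "legendre_hadamard M
           (\<lambda>i j \<alpha> \<beta> z. 2 * a i j \<alpha> \<beta> z - (p - 1) * contraction \<sigma> i j \<alpha> \<beta> z)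
         \<or> legendre_hadamard M
           (\<lambda>i j \<alpha> \<beta> z. 2 * a i j \<alpha> \<beta> z - contraction \<sigma> i j \<alpha> \<beta> z
              - (p - 2) * contraction (antisym_part \<sigma>) i j \<alpha> \<beta> z)"
  shows "MSP_condition M p a \<sigma>"
proof -
  let ?Z = "param_space M"
  note ell2 = assms(4)[unfolded ell2_measurable_def]
  have meas [measurable]: "\<sigma> i k \<alpha> \<beta> \<in> borel_measurable ?Z" for i k \<alpha> \<beta>
    using ell2[of i \<alpha> \<beta>] by simp
  have sq: "summable (\<lambda>k. (\<sigma> i k \<alpha> \<beta> z)\<^sup>2)" if "z \<in> space ?Z" for i \<alpha> \<beta> z
    using ell2[of i \<alpha> \<beta>] that by blast
  from assms(5) show ?thesis
  proof
    assume "legendre_hadamard M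
      (\<lambda>i j \<alpha> \<beta> z. 2 * a i j \<alpha> \<beta> z - (p - 1) * contraction \<sigma> i j \<alpha> \<beta> z)"
    moreover have "MSP_form p a \<sigma> (\<lambda>i k \<alpha> \<beta> z. 0)
        = (\<lambda>i j \<alpha> \<beta> z. 2 * a i j \<alpha> \<beta> z - (p - 1) * contraction \<sigma> i j \<alpha> \<beta> z)"
      by (intro ext) (simp add: MSP_form_def algebra_simps)
    ultimately show ?thesis
      unfolding MSP_condition_def
      by (intro exI[of _ "\<lambda>i k \<alpha> \<beta> z. 0"])
        (simp add: summable_mult_of_summable_squares sq)
  next
    \<comment> \<open>The symmetric part of \<open>\<sigma>\<close> in \<alpha>, \<beta>, chosen so
      that subtracting it leaves \<open>antisym_part \<sigma>\<close>.\<close>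
    define l where "l = (\<lambda>i k \<alpha> \<beta> z. (\<sigma> i k \<alpha> \<beta> z + \<sigma> i k \<beta> \<alpha> z) / 2)"
    assume LH: "legendre_hadamard M
      (\<lambda>i j \<alpha> \<beta> z. 2 * a i j \<alpha> \<beta> z - contraction \<sigma> i j \<alpha> \<beta> z
         - (p - 2) * contraction (antisym_part \<sigma>) i j \<alpha> \<beta> z)"
    have diff: "\<sigma> i k \<alpha> \<beta> z - l i k \<alpha> \<beta> z = antisym_part \<sigma> i k \<alpha> \<beta> z" for i k \<alpha> \<beta> z
      by (simp add: l_def antisym_part_def field_simps)
    have "l i k \<alpha> \<beta> \<in> borel_measurable ?Z" for i k \<alpha> \<beta>
      unfolding l_def by measurable
    moreover have "l i k \<alpha> \<beta> z = l i k \<beta> \<alpha> z" for i k \<alpha> \<beta> z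
      by (simp add: l_def add.commute)
    moreover have "summable (\<lambda>k. (\<sigma> i k \<gamma> \<alpha> z - l i k \<gamma> \<alpha> z) * (\<sigma> j k \<gamma> \<beta> z - l j k \<gamma> \<beta> z))"
      if "z \<in> space ?Z" for i j \<alpha> \<beta> \<gamma> z
      unfolding diff antisym_part_def
      by (intro summable_mult_of_summable_squares summable_square_half_diff sq that)
    \<comment> \<open>Rewriting with \<open>diff\<close> under the binders turns the MSP form into
      exactly the form in \<open>LH\<close>.\<close>
    moreover have "legendre_hadamard M (MSP_form p a \<sigma> l)"
      using LH unfolding MSP_form_def[abs_def] diff .
    ultimately show ?thesis
      unfolding MSP_condition_def by (intro exI[of _ l] conjI allI ballI)
  qed
qed

end
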